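(* Let $d,T\in\mathbb{N}$, $0<p\le 2$, $L>0$, and let $\eta_1,\dots,\eta_T>0$, $\sigma_1,\dots,\sigma_T>0$. Consider a noisy iterative algorithm in $\mathbb{R}^d$ with update rule $W_t=g(W_{t-1})-\eta_tF(W_{t-1},Z_t)+\xi_t$, $1\le t\le T$, as described in the context, with final output $W$ (a function of $W^T=(W_1,\dots,W_T)$). Suppose that $P(Z_{t+1}\mid Z^t,W^t,S)=P(Z_{t+1}\mid Z^t,S)$ for all $t$, that $\sup_{w,z}\|F(w,z)\|_p\le L$, and that $\xi_t\sim\mathcal{N}(0,\sigma_t^2I_d)$ for every $t$. Then $$\mathcal{L}(S\to W)\le\sum_{t=1}^T\log\left(\frac{V_2(d,\eta_tL)}{(2\pi\sigma_t^2)^{d/2}}+\frac{1}{\Gamma\left(\frac d2\right)}\sum_{i=0}^{d-1}\binom{d-1}{i}\Gamma\left(\frac{i+1}{2}\right)\left(\frac{\eta_tL}{\sigma_t\sqrt2}\right)^{d-1-i}\right),$$ where $V_2(d,r)=\dfrac{\pi^{d/2}}{\Gamma\left(\frac d2+1\right)}\,r^d$.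
   Context: Maximal leakage: for random variables $X,Y$ with joint law $P_{XY}$, $\mathcal{L}(X\to Y)=I_\infty(X,Y)=\min_{Q_Y}D_\infty(P_{XY}\|P_XQ_Y)=\log\mathbb{E}_{P_Y}\big[\operatorname{ess\,sup}_{P_X}\frac{dP_{XY}}{d(P_XP_Y)}\big]$, where $D_\infty$ is the Rényi divergence of order $\infty$. If $X,Y$ are jointly continuous this equals $\log\int\operatorname{ess\,sup}_{P_X}f_{Y|X}(y|x)\,dy$. Logarithms are natural. Setup: $S=(Z'_1,\dots,Z'_n)$ is a data set of $n$ i.i.d. samples from an unknown distribution on a sample space $\mathcal{Z}$. The algorithm generates $W_t=g(W_{t-1})-\eta_tF(W_{t-1},Z_t)+\xi_t$ for $t=1,\dots,T$, where $Z_t\subseteq S$ is a (possibly random) subset (mini-batch) of the data sampled according to some distribution, $g:\mathbb{R}^d\to\mathbb{R}^d$ is a deterministic function, $F(w,z)\in\mathbb{R}^d$ is a direction (e.g. a gradient), $\eta_t$ is the step-size, and $\xi_t$ is an $\mathbb{R}^d$-valued noise with an absolutely continuous distribution. The initial point $W_0$ is independent of $(S,Z_1,\dots,Z_T)$, and the noises $\xi_1,\dots,\xi_T$ are mutually independent and independent of $(W_0,S,Z_1,\dots,Z_T)$; thus $P(W_{t+1}\mid W^t,Z^T,S)=P(W_{t+1}\mid W_t,Z_{t+1})$. Notation: $W^t=(W_1,\dots,W_t)$, $Z^t=(Z_1,\dots,Z_t)$. $\|x\|_p=(\sum_i|x_i|^p)^{1/p}$ for $0<p<\infty$. *)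

theory Defs
  imports "HOL-Probability.Probability" "HOL-Library.Multiset"
begin

text \<open>Finite sequences of random variables are indexed from 1 and regarded as random elements of
  a finite product space.\<close>

abbreviation tuple :: "nat \<Rightarrow> (nat \<Rightarrow> 'a \<Rightarrow> 'b) \<Rightarrow> 'a \<Rightarrow> nat \<Rightarrow> 'b" where
  "tuple n X \<omega> \<equiv> (\<lambda>i\<in>{1..n}. X i \<omega>)"

abbreviation pow_space :: "nat \<Rightarrow> 'b measure \<Rightarrow> (nat \<Rightarrow> 'b) measure" where
  "pow_space n N \<equiv> PiM {1..n} (\<lambda>_. N)"

text \<open>The library constant \<^const>\<open>prob_space.indep_var\<close> forces both random variables to have
  the same value type; here independence is that of the generated sigma-algebras.\<close>

definition indep_rv ::
    "'a measure \<Rightarrow> 'b measure \<Rightarrow> ('a \<Rightarrow> 'b) \<Rightarrow> 'c measure \<Rightarrow> ('a \<Rightarrow> 'c) \<Rightarrow> bool" where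
  "indep_rv M N X K Y \<longleftrightarrow> X \<in> measurable M N \<and> Y \<in> measurable M K \<and>
     prob_space.indep_set M (sets (vimage_algebra (space M) X N)) (sets (vimage_algebra (space M) Y K))"

text \<open>A version of the conditional probability of the event that \<open>Y \<in> A\<close> given \<open>X\<close>, as a
  random variable on \<open>M\<close>; it is determined up to a null set.\<close>

definition cond_prob_given ::
    "'a measure \<Rightarrow> ('a \<Rightarrow> 'b) \<Rightarrow> 'b set \<Rightarrow> 'c measure \<Rightarrow> ('a \<Rightarrow> 'c) \<Rightarrow> 'a \<Rightarrow> real" where
  "cond_prob_given M Y A K X =
     real_cond_exp M (vimage_algebra (space M) X K) (\<lambda>\<omega>. indicator A (Y \<omega>))"

definition ln_ext :: "ennreal \<Rightarrow> ereal" where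
  "ln_ext x = (if x = 0 then -\<infinity> else if x = \<infinity> then \<infinity> else ereal (ln (enn2real x)))"

definition renyi_div_inf :: "'a measure \<Rightarrow> 'a measure \<Rightarrow> ereal" where
  "renyi_div_inf P Q =
     (if absolutely_continuous Q P then ln_ext (esssup P (RN_deriv Q P)) else \<infinity>)"

text \<open>Maximal leakage from \<open>X\<close> to \<open>Y\<close>, in its form as Sibson's mutual information of order
  infinity: the minimum of the order-infinity Renyi divergence of the joint law from \<open>P\<^sub>X \<otimes> Q\<close>
  over all probability measures \<open>Q\<close> on the space of \<open>Y\<close>.\<close>

definition maximal_leakage ::
    "'a measure \<Rightarrow> 'b measure \<Rightarrow> ('a \<Rightarrow> 'b) \<Rightarrow> 'c measure \<Rightarrow> ('a \<Rightarrow> 'c) \<Rightarrow> ereal" where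
  "maximal_leakage M N X K Y =
     (INF Q \<in> {Q. prob_space Q \<and> sets Q = sets K}.
        renyi_div_inf (distr M (N \<Otimes>\<^sub>M K) (\<lambda>\<omega>. (X \<omega>, Y \<omega>))) (distr M N X \<Otimes>\<^sub>M Q))"

definition lp_norm :: "real \<Rightarrow> real ^ 'd \<Rightarrow> real" where
  "lp_norm p x = (\<Sum>i\<in>UNIV. \<bar>x $ i\<bar> powr p) powr (1 / p)"

definition iso_normal_density :: "real \<Rightarrow> real ^ 'd \<Rightarrow> real" where
  "iso_normal_density \<sigma> x =
     exp (- (norm x)\<^sup>2 / (2 * \<sigma>\<^sup>2)) / (2 * pi * \<sigma>\<^sup>2) powr (real CARD('d) / 2)"

definition V2 :: "nat \<Rightarrow> real \<Rightarrow> real" where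
  "V2 d r = pi powr (real d / 2) / Gamma (real d / 2 + 1) * r ^ d"

end

theory Submission
  imports Defs
begin

text \<open>Put \<open>\<zeta>\<^sub>t = \<xi>\<^sub>t - \<eta>\<^sub>t F(W\<^sub>t\<^sub>-\<^sub>1, Z\<^sub>t)\<close>, so that \<open>W\<^sub>t = g(W\<^sub>t\<^sub>-\<^sub>1) + \<zeta>\<^sub>t\<close>. Given the data, the
  mini-batches and the past, \<open>\<zeta>\<^sub>t\<close> is a Gaussian shifted by a vector of Euclidean norm at most
  \<open>r\<^sub>t = \<eta>\<^sub>t L\<close>, so its density is at most the pointwise supremum \<open>h\<^sub>t\<close> of all such shifted densities.
  Hence the joint law of \<open>(W\<^sub>0, S, Z\<^sup>T)\<close> and \<open>\<zeta>\<^sup>T\<close> is bounded by the product of the law of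
  \<open>(W\<^sub>0, S, Z\<^sup>T)\<close> with the measure of density \<open>\<Prod>\<^sub>t h\<^sub>t\<close>. As \<open>W\<^sup>T\<close> is a function of \<open>W\<^sub>0\<close> and
  \<open>\<zeta>\<^sup>T\<close>, and \<open>W\<^sub>0\<close> is independent of \<open>S\<close>, normalising gives a law \<open>Q\<close> of the output such that the joint
  law of \<open>S\<close> and the output is at most \<open>\<Prod>\<^sub>t \<integral>h\<^sub>t\<close> times \<open>P\<^sub>S \<otimes> Q\<close>; and \<open>\<integral>h\<^sub>t\<close> is computed in polar
  coordinates: the ball of radius \<open>r\<^sub>t\<close> gives the \<open>V2\<close> term, its complement the sum.\<close>

subsection \<open>Radial Gaussian integrals\<close>

text \<open>The half-lines \<open>{..a}\<close> form a generating pi-system, and the preimage of one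
  under the norm is a closed ball. The density is the derivative of the ball volume in the radius.
  For radial integrands this is integration in polar coordinates.\<close>

lemma distr_lborel_norm:
  "distr lborel borel (norm :: 'a::euclidean_space \<Rightarrow> real) =
     density lborel (\<lambda>s. ennreal (real DIM('a) * unit_ball_vol (real DIM('a)) * s ^ (DIM('a) - 1)) * indicator {0..} s)"
  (is "?L = density lborel ?f")
proof (rule measure_eqI_generator_eq[where E = "range (\<lambda>a::real. {..a})" and \<Omega> = UNIV and A = "\<lambda>i. {..real i}"])
  show "Int_stable (range (\<lambda>a::real. {..a}))"
    by (auto simp: Int_stable_def)
  show "range (\<lambda>a::real. {..a}) \<subseteq> Pow UNIV" by simp
  show "sets ?L = sigma_sets UNIV (range (\<lambda>a::real. {..a}))"
    by (simp add: borel_eq_atMost)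
  show "sets (density lborel ?f) = sigma_sets UNIV (range (\<lambda>a::real. {..a}))"
    by (simp add: borel_eq_atMost)
  show "range (\<lambda>i. {..real i}) \<subseteq> range (\<lambda>a::real. {..a})" by auto
  show "(\<Union>i. {..real i}) = UNIV"
    by (auto intro: real_arch_simple)
  have L: "emeasure ?L {..a} = (if a < 0 then 0 else ennreal (unit_ball_vol (real DIM('a)) * a ^ DIM('a)))" for a :: real
  proof -
    have "norm -` {..a} = (cball 0 a :: 'a set)" by auto
    then show ?thesis
      by (simp add: emeasure_distr emeasure_cball)
  qed
  show "emeasure ?L {..real i} \<noteq> \<infinity>" for i
    by (simp add: L)
  show "emeasure ?L X = emeasure (density lborel ?f) X" if "X \<in> range (\<lambda>a::real. {..a})" for X
  proof -
    from that obtain a where X: "X = {..a}" by auto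
    have eq: "?f s * indicator {..a} s =
        ennreal (real DIM('a) * unit_ball_vol (real DIM('a)) * s ^ (DIM('a) - 1)) * indicator {0..a} s" for s
      by (simp add: indicator_def)
    have "emeasure (density lborel ?f) X =
        (\<integral>\<^sup>+s. ennreal (real DIM('a) * unit_ball_vol (real DIM('a)) * s ^ (DIM('a) - 1)) * indicator {0..a} s \<partial>lborel)"
      unfolding X by (subst emeasure_density) (simp_all only: eq, auto)
    also have "\<dots> = (if a < 0 then 0 else ennreal (unit_ball_vol (real DIM('a)) * a ^ DIM('a)))"
    proof (cases "a < 0")
      case False
      then show ?thesis
        by (subst nn_integral_FTC_Icc[where F = "\<lambda>s. unit_ball_vol (real DIM('a)) * s ^ DIM('a)"])
          (auto intro!: derivative_eq_intros)
    qed simp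
    finally show ?thesis by (simp add: X L)
  qed
qed

text \<open>Brings half-integer Gamma values into the factorial form of the even Gaussian
  moments.\<close>

lemma Gamma_half_nat:
  "Gamma (real k + 1 / 2) = sqrt pi * (fact (2 * k) / (2 ^ (2 * k) * fact k))"
proof (induction k)
  case 0
  then show ?case by (simp add: Gamma_one_half_real)
next
  case (Suc k)
  have "Gamma (real (Suc k) + 1 / 2) = (real k + 1 / 2) * Gamma (real k + 1 / 2)"
    using Gamma_plus1[of "real k + 1 / 2"] by (simp add: add_ac nonpos_Ints_def)
  also have "\<dots> = (real k + 1 / 2) * (sqrt pi * (fact (2 * k) / (2 ^ (2 * k) * fact k)))"
    by (simp only: Suc)
  also have "\<dots> = sqrt pi * (fact (2 * Suc k) / (2 ^ (2 * Suc k) * fact (Suc k)))"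
    by (simp add: divide_simps) (simp add: algebra_simps)
  finally show ?case .
qed

text \<open>Both parities of \<open>i\<close> are known half-line Gaussian moments: for even
  \<open>i\<close> the Gamma value is taken at a half-integer, for odd \<open>i\<close> it is a
  factorial.\<close>

lemma nn_integral_power_exp_neg_square:
  "(\<integral>\<^sup>+x. ennreal (x ^ i * exp (- x\<^sup>2)) * indicator {0..} x \<partial>lborel) = ennreal (Gamma ((real i + 1) / 2) / 2)"
proof -
  have *: "(\<integral>\<^sup>+x. ennreal (x ^ i * exp (- x\<^sup>2)) * indicator {0..} x \<partial>lborel) = ennreal c"
    if "has_bochner_integral lborel (\<lambda>x. indicator {0..} x *\<^sub>R (exp (- x\<^sup>2) * x ^ i)) c" for c
  proof -
    have "(\<integral>\<^sup>+x. ennreal (x ^ i * exp (- x\<^sup>2)) * indicator {0..} x \<partial>lborel) =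
        (\<integral>\<^sup>+x. ennreal (indicator {0..} x *\<^sub>R (exp (- x\<^sup>2) * x ^ i)) \<partial>lborel)"
      by (intro nn_integral_cong) (simp add: indicator_def mult.commute)
    also have "\<dots> = ennreal c"
      using that nn_integral_eq_integral[of lborel "\<lambda>x. indicator {0..} x *\<^sub>R (exp (- x\<^sup>2) * x ^ i)"]
      by (simp add: has_bochner_integral_iff indicator_def)
    finally show ?thesis .
  qed
  show ?thesis
  proof (cases "even i")
    case True
    then obtain k where i: "i = 2 * k" by (elim evenE)
    have "Gamma ((real i + 1) / 2) / 2 = sqrt pi / 2 * (fact (2 * k) / (2 ^ (2 * k) * fact k))"
      using Gamma_half_nat[of k] by (simp add: i add_divide_distrib)
    then show ?thesis
      using *[OF gaussian_moment_even_pos[of k, folded i]] by (simp only: i)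
  next
    case False
    then obtain k where i: "i = 2 * k + 1" by (elim oddE)
    have "(real i + 1) / 2 = 1 + real k" by (simp add: i field_simps)
    then show ?thesis
      using *[OF gaussian_moment_odd_pos[of k, folded i]] by (simp only: Gamma_fact)
  qed
qed

text \<open>The substitution \<open>s = r + \<tau> * x\<close> turns the exponential into
  \<open>exp (- x\<^sup>2)\<close>. The binomial expansion of \<open>(r + \<tau> * x) ^ k\<close>
  leaves one Gamma integral per term, and the Jacobian supplies the extra factor in
  \<open>\<tau> ^ Suc i\<close>.\<close>

lemma nn_integral_radial_tail:
  fixes r \<tau> :: real
  assumes "0 < \<tau>" "0 \<le> r"
  shows "(\<integral>\<^sup>+s. ennreal (s ^ k * exp (- ((s - r) / \<tau>)\<^sup>2)) * indicator {r..} s \<partial>lborel) =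
     ennreal (\<Sum>i\<le>k. real (k choose i) * \<tau> ^ Suc i * r ^ (k - i) * (Gamma ((real i + 1) / 2) / 2))"
proof -
  have "(\<integral>\<^sup>+s. ennreal (s ^ k * exp (- ((s - r) / \<tau>)\<^sup>2)) * indicator {r..} s \<partial>lborel) =
      \<bar>\<tau>\<bar> * (\<integral>\<^sup>+x. ennreal ((r + \<tau> * x) ^ k * exp (- ((r + \<tau> * x - r) / \<tau>)\<^sup>2)) * indicator {r..} (r + \<tau> * x) \<partial>lborel)"
    by (rule nn_integral_real_affine) (use assms in auto)
  also have "\<dots> = (\<integral>\<^sup>+x. ennreal \<tau> * (ennreal ((r + \<tau> * x) ^ k * exp (- x\<^sup>2)) * indicator {0..} x) \<partial>lborel)"
    using assms by (subst nn_integral_cmult[symmetric]) (auto intro!: nn_integral_cong simp: indicator_def zero_le_mult_iff)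
  also have "\<dots> = (\<integral>\<^sup>+x. (\<Sum>i\<le>k. ennreal (real (k choose i) * \<tau> ^ Suc i * r ^ (k - i)) * (ennreal (x ^ i * exp (- x\<^sup>2)) * indicator {0..} x)) \<partial>lborel)"
  proof (intro nn_integral_cong, goal_cases)
    case (1 x)
    show ?case
    proof (cases "x \<ge> 0")
      case True
      have "\<tau> * ((r + \<tau> * x) ^ k * exp (- x\<^sup>2)) =
          (\<Sum>i\<le>k. real (k choose i) * \<tau> ^ Suc i * r ^ (k - i) * (x ^ i * exp (- x\<^sup>2)))"
        \<comment> \<open>With the summands swapped, the binomial formula gives
          \<open>\<tau> * x\<close> the exponent \<open>i\<close>.\<close>
        by (subst add.commute) (simp add: binomial_ring sum_distrib_left sum_distrib_right power_mult_distrib mult_ac)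
      then show ?thesis
        using True assms by (simp flip: ennreal_mult' add: sum_ennreal)
    qed simp
  qed
  also have "\<dots> = (\<Sum>i\<le>k. ennreal (real (k choose i) * \<tau> ^ Suc i * r ^ (k - i)) * ennreal (Gamma ((real i + 1) / 2) / 2))"
    by (simp add: nn_integral_sum nn_integral_cmult nn_integral_power_exp_neg_square)
  also have "\<dots> = ennreal (\<Sum>i\<le>k. real (k choose i) * \<tau> ^ Suc i * r ^ (k - i) * (Gamma ((real i + 1) / 2) / 2))"
    using assms by (simp add: sum_ennreal Gamma_real_pos less_imp_le flip: ennreal_mult')
  finally show ?thesis .
qed

text \<open>The supremum of \<open>iso_normal_density \<sigma> (x + u)\<close> over \<open>norm u \<le> r\<close>.\<close>

definition swollen_normal_density :: "real \<Rightarrow> real \<Rightarrow> real ^ 'd \<Rightarrow> real" where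
  "swollen_normal_density \<sigma> r x =
     exp (- (max 0 (norm x - r))\<^sup>2 / (2 * \<sigma>\<^sup>2)) / (2 * pi * \<sigma>\<^sup>2) powr (real CARD('d) / 2)"

lemma swollen_normal_density_measurable [measurable]:
  "swollen_normal_density \<sigma> r \<in> borel_measurable borel"
  unfolding swollen_normal_density_def by measurable

lemma swollen_normal_density_nonneg: "0 \<le> swollen_normal_density \<sigma> r x"
  by (simp add: swollen_normal_density_def)

text \<open>By the triangle inequality \<open>x + u\<close> has norm at least
  \<open>max 0 (norm x - r)\<close>, and the Gaussian density decreases in the norm.\<close>

lemma iso_normal_density_le_swollen:
  assumes "norm u \<le> r"
  shows "iso_normal_density \<sigma> (x + u) \<le> swollen_normal_density \<sigma> r x"
proof -
  have "norm x \<le> norm (x + u) + norm u"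
    using norm_triangle_ineq4[of "x + u" u] by simp
  then have "(max 0 (norm x - r))\<^sup>2 \<le> (norm (x + u))\<^sup>2"
    using assms by (intro power_mono) auto
  then show ?thesis
    by (auto simp: iso_normal_density_def swollen_normal_density_def intro!: divide_right_mono)
qed

text \<open>The radial profile is constant up to radius \<open>r\<close>, which yields the
  \<open>V2\<close> term. Beyond \<open>r\<close> it is a Gaussian centred at \<open>r\<close>,
  weighted by a power of the radius, so \<open>nn_integral_radial_tail\<close> yields the
  sum.\<close>

lemma nn_integral_swollen_normal_density:
  fixes \<sigma> r :: real
  assumes "0 < \<sigma>" "0 \<le> r"
  shows "(\<integral>\<^sup>+x. ennreal (swollen_normal_density \<sigma> r (x :: real ^ 'd)) \<partial>lborel) =
    ennreal (V2 CARD('d) r / (2 * pi * \<sigma>\<^sup>2) powr (real CARD('d) / 2)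
        + 1 / Gamma (real CARD('d) / 2) *
          (\<Sum>i=0..CARD('d) - 1. real ((CARD('d) - 1) choose i) * Gamma ((real i + 1) / 2) *
             (r / (\<sigma> * sqrt 2)) ^ (CARD('d) - 1 - i)))"
proof -
  define D where "D = CARD('d)"
  have D: "D > 0" by (simp add: D_def)
  define v where "v = unit_ball_vol (real D)"
  define c where "c = 1 / (2 * pi * \<sigma>\<^sup>2) powr (real D / 2)"
  \<comment> \<open>The scale for which the Gaussian exponent reads
    \<open>- ((s - r) / \<tau>)\<^sup>2\<close>.\<close>
  define \<tau> where "\<tau> = \<sigma> * sqrt 2"
  have \<tau>: "\<tau> > 0" using assms by (simp add: \<tau>_def)
  have \<tau>2: "\<tau>\<^sup>2 = 2 * \<sigma>\<^sup>2" by (simp add: \<tau>_def power_mult_distrib)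
  have c: "c \<ge> 0" by (simp add: c_def)
  have v: "v \<ge> 0" by (simp add: v_def)
  define S where "S = (\<Sum>i\<le>D - 1. real ((D - 1) choose i) * \<tau> ^ Suc i * r ^ (D - 1 - i) * (Gamma ((real i + 1) / 2) / 2))"
  have S: "S \<ge> 0" unfolding S_def
    using assms \<tau> by (intro sum_nonneg mult_nonneg_nonneg) (auto simp: Gamma_real_pos less_imp_le)
  define h where "h s = c * exp (- (max 0 (s - r))\<^sup>2 / (2 * \<sigma>\<^sup>2))" for s
  have h0: "h s \<ge> 0" for s using c by (simp add: h_def)
  have [measurable]: "h \<in> borel_measurable borel" unfolding h_def by measurable
  have "(\<integral>\<^sup>+x. ennreal (swollen_normal_density \<sigma> r (x :: real ^ 'd)) \<partial>lborel) =
      (\<integral>\<^sup>+x. ennreal (h (norm (x :: real ^ 'd))) \<partial>lborel)"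
    by (simp add: swollen_normal_density_def h_def c_def D_def)
  also have "\<dots> = (\<integral>\<^sup>+s. ennreal (h s) \<partial>distr lborel borel (norm :: real ^ 'd \<Rightarrow> real))"
    by (subst nn_integral_distr) auto
  also have "\<dots> = (\<integral>\<^sup>+s. ennreal (real D * v * s ^ (D - 1)) * indicator {0..} s * ennreal (h s) \<partial>lborel)"
    unfolding distr_lborel_norm by (subst nn_integral_density) (auto simp: D_def v_def)
  \<comment> \<open>The half-line is cut at \<open>r\<close>. Both indicators contain
    \<open>r\<close>, so the integrands may differ at that single point, which is a null
    set.\<close>
  also have "\<dots> = (\<integral>\<^sup>+s. ennreal (c * v * (real D * s ^ (D - 1))) * indicator {0..r} s +
       ennreal (c * real D * v) * (ennreal (s ^ (D - 1) * exp (- ((s - r) / \<tau>)\<^sup>2)) * indicator {r..} s) \<partial>lborel)"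
  proof (rule nn_integral_cong_AE, rule AE_mp[OF AE_lborel_singleton[of r]], intro AE_I2 impI, goal_cases)
    case (1 s)
    then show ?case
      using assms v c \<tau> h0
      by (auto simp: indicator_def h_def power_divide \<tau>2 max_def mult_ac simp flip: ennreal_mult')
  qed
  also have "\<dots> = (\<integral>\<^sup>+s. ennreal (c * v * (real D * s ^ (D - 1))) * indicator {0..r} s \<partial>lborel) +
       ennreal (c * real D * v) * ennreal S"
    by (subst nn_integral_add; simp add: nn_integral_cmult)
       (simp add: nn_integral_radial_tail[OF \<tau> assms(2)] S_def)
  also have "(\<integral>\<^sup>+s. ennreal (c * v * (real D * s ^ (D - 1))) * indicator {0..r} s \<partial>lborel) = ennreal (c * v * r ^ D)"
    using assms v c D by (subst nn_integral_FTC_Icc[where F = "\<lambda>s. c * v * s ^ D"])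
      (auto intro!: derivative_eq_intros simp: zero_power)
  also have "ennreal (c * v * r ^ D) + ennreal (c * real D * v) * ennreal S = ennreal (c * v * r ^ D + c * real D * v * S)"
    using assms v c S by (simp flip: ennreal_mult')
  also have "c * v * r ^ D = V2 D r / (2 * pi * \<sigma>\<^sup>2) powr (real D / 2)"
    by (simp add: V2_def v_def unit_ball_vol_def c_def)
  also have "c * real D * v * S = 1 / Gamma (real D / 2) *
          (\<Sum>i=0..D - 1. real ((D - 1) choose i) * Gamma ((real i + 1) / 2) * (r / \<tau>) ^ (D - 1 - i))"
  proof -
    have "c = 1 / (pi powr (real D / 2) * \<tau> ^ D)"
    proof -
      have "(2 * pi * \<sigma>\<^sup>2) powr (real D / 2) = (pi * \<tau>\<^sup>2) powr (real D / 2)"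
        by (simp add: \<tau>2 mult_ac)
      also have "\<dots> = pi powr (real D / 2) * (\<tau> powr 2) powr (real D / 2)"
        using \<tau> by (simp add: powr_mult)
      also have "\<dots> = pi powr (real D / 2) * \<tau> ^ D"
        using \<tau> by (simp add: powr_powr powr_realpow del: powr_numeral)
      finally show ?thesis by (simp add: c_def)
    qed
    \<comment> \<open>This is the area of the unit sphere, obtained from
      \<open>Gamma (x + 1) = x * Gamma x\<close> at \<open>x = D / 2\<close>.\<close>
    moreover have "real D * v = 2 * pi powr (real D / 2) / Gamma (real D / 2)"
    proof -
      have "Gamma (real D / 2 + 1) = real D / 2 * Gamma (real D / 2)"
        using D by (intro Gamma_plus1) (auto simp: nonpos_Ints_def)
      moreover have "Gamma (real D / 2) > 0" using D by (intro Gamma_real_pos) simp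
      ultimately show ?thesis using D by (simp only: v_def unit_ball_vol_def) (simp add: divide_simps)
    qed
    ultimately have "c * real D * v = 2 / (Gamma (real D / 2) * \<tau> ^ D)"
      by (simp add: mult.assoc)
    then have "c * real D * v * S = 1 / Gamma (real D / 2) * (2 * S / \<tau> ^ D)"
      by simp
    \<comment> \<open>The factor 2 cancels the halves of the Gamma integrals, and
      \<open>\<tau> ^ Suc i\<close> against \<open>\<tau> ^ D\<close> leaves the denominator of
      \<open>(r / \<tau>) ^ (D - 1 - i)\<close>.\<close>
    also have "2 * S / \<tau> ^ D = (\<Sum>i=0..D - 1. real ((D - 1) choose i) * Gamma ((real i + 1) / 2) * (r / \<tau>) ^ (D - 1 - i))"
      unfolding S_def sum_distrib_left sum_divide_distrib atLeast0AtMost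
    proof (intro sum.cong refl, goal_cases)
      case (1 i)
      then have "\<tau> ^ D = \<tau> ^ Suc i * \<tau> ^ (D - 1 - i)"
        using D by (simp flip: power_add power_Suc)
      then show ?case using \<tau> by (simp add: power_divide field_simps)
    qed
    finally show ?thesis .
  qed
  finally show ?thesis by (simp add: D_def \<tau>_def)
qed

section \<open>Comparison of the Euclidean norm with \<open>lp_norm\<close>\<close>

text \<open>Write each squared coordinate as a \<open>p\<close>-th power times a
  \<open>(2 - p)\<close>-th power. The latter is at most \<open>S powr ((2 - p) / p)\<close> because
  a single \<open>p\<close>-th power is at most the sum \<open>S\<close>; summing gives
  \<open>S powr (2 / p)\<close>.\<close>

lemma norm_le_lp_norm:
  fixes x :: "real ^ 'd"
  assumes "0 < p" "p \<le> 2"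
  shows "norm x \<le> lp_norm p x"
proof -
  define S where "S = (\<Sum>i\<in>UNIV. \<bar>x $ i\<bar> powr p)"
  have S: "S \<ge> 0" unfolding S_def by (intro sum_nonneg) auto
  have "(x $ i)\<^sup>2 \<le> \<bar>x $ i\<bar> powr p * S powr ((2 - p) / p)" for i
  proof (cases "x $ i = 0")
    case False
    have "\<bar>x $ i\<bar> powr p \<le> S"
      unfolding S_def by (rule member_le_sum) auto
    then have "(\<bar>x $ i\<bar> powr p) powr ((2 - p) / p) \<le> S powr ((2 - p) / p)"
      using assms by (intro powr_mono2) auto
    then have "\<bar>x $ i\<bar> powr p * \<bar>x $ i\<bar> powr (2 - p) \<le> \<bar>x $ i\<bar> powr p * S powr ((2 - p) / p)"
      using assms by (intro mult_left_mono) (auto simp: powr_powr)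
    moreover have "\<bar>x $ i\<bar> powr p * \<bar>x $ i\<bar> powr (2 - p) = (x $ i)\<^sup>2"
      using False by (simp flip: powr_add)
    ultimately show ?thesis by simp
  qed simp
  then have "(\<Sum>i\<in>UNIV. (x $ i)\<^sup>2) \<le> S * S powr ((2 - p) / p)"
    unfolding S_def sum_distrib_right by (intro sum_mono)
  also have "\<dots> = (S powr (1 / p))\<^sup>2"
  proof (cases "S = 0")
    case False
    then have "S * S powr ((2 - p) / p) = S powr (1 + (2 - p) / p)"
      using S by (simp add: powr_add)
    also have "1 + (2 - p) / p = 1 / p * 2" using assms by (simp add: field_simps)
    also have "S powr (1 / p * 2) = (S powr (1 / p)) powr 2" by (simp only: powr_powr)
    finally show ?thesis using False S by simp
  qed simp
  finally show ?thesis
    unfolding norm_vec_def L2_set_def lp_norm_def S_def by (intro real_le_lsqrt) auto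
qed

subsection \<open>Independence of random variables with different value types\<close>

lemma indep_rv_measurable:
  assumes "indep_rv M N X K Y"
  shows "X \<in> measurable M N" "Y \<in> measurable M K"
  using assms by (auto simp: indep_rv_def)

lemma indep_rv_sym:
  assumes "prob_space M" "indep_rv M N X K Y"
  shows "indep_rv M K Y N X"
proof -
  interpret prob_space M by fact
  have XY: "X \<in> measurable M N" "Y \<in> measurable M K"
    "indep_set (sets (vimage_algebra (space M) X N)) (sets (vimage_algebra (space M) Y K))"
    using assms(2) by (auto simp: indep_rv_def)
  have "indep_set (sets (vimage_algebra (space M) Y K)) (sets (vimage_algebra (space M) X N))"
  proof (rule indep_setI)
    fix a b assume ab: "a \<in> sets (vimage_algebra (space M) Y K)" "b \<in> sets (vimage_algebra (space M) X N)"
    show "prob (a \<inter> b) = prob a * prob b"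
      using indep_setD[OF XY(3) ab(2,1)] by (simp only: Int_commute mult.commute)
  qed (use XY(3) in \<open>simp_all add: indep_sets2_eq\<close>)
  with XY show ?thesis by (simp add: indep_rv_def)
qed

lemma indep_rv_distr_pair:
  assumes "prob_space M" "indep_rv M N X K Y"
  shows "distr M (N \<Otimes>\<^sub>M K) (\<lambda>\<omega>. (X \<omega>, Y \<omega>)) = distr M N X \<Otimes>\<^sub>M distr M K Y"
proof (rule sym, rule pair_measure_eqI)
  interpret prob_space M by fact
  note [measurable] = indep_rv_measurable[OF assms(2)]
  interpret X: prob_space "distr M N X" by (rule prob_space_distr) measurable
  interpret Y: prob_space "distr M K Y" by (rule prob_space_distr) measurable
  show "sigma_finite_measure (distr M N X)" "sigma_finite_measure (distr M K Y)"
    by unfold_locales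
  fix A B assume "A \<in> sets (distr M N X)" "B \<in> sets (distr M K Y)"
  then have [measurable]: "A \<in> sets N" "B \<in> sets K" by auto
  have "prob ((X -` A \<inter> space M) \<inter> (Y -` B \<inter> space M)) = prob (X -` A \<inter> space M) * prob (Y -` B \<inter> space M)"
    using assms(2) by (intro indep_setD) (auto simp: indep_rv_def in_vimage_algebra)
  moreover have "(\<lambda>\<omega>. (X \<omega>, Y \<omega>)) -` (A \<times> B) \<inter> space M = (X -` A \<inter> space M) \<inter> (Y -` B \<inter> space M)"
    by auto
  ultimately show "emeasure (distr M N X) A * emeasure (distr M K Y) B =
      emeasure (distr M (N \<Otimes>\<^sub>M K) (\<lambda>\<omega>. (X \<omega>, Y \<omega>))) (A \<times> B)"
    by (simp add: emeasure_distr emeasure_eq_measure flip: ennreal_mult')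
qed simp

text \<open>Converse of \<open>indep_rv_distr_pair\<close>: events of the generated sigma-algebras
  are preimages, so the product law need only be evaluated on rectangles.\<close>

lemma indep_rvI_distr_pair:
  assumes "prob_space M" and [measurable]: "X \<in> measurable M N" "Y \<in> measurable M K"
    and eq: "distr M (N \<Otimes>\<^sub>M K) (\<lambda>\<omega>. (X \<omega>, Y \<omega>)) = distr M N X \<Otimes>\<^sub>M distr M K Y"
  shows "indep_rv M N X K Y"
proof -
  interpret prob_space M by fact
  interpret Y: prob_space "distr M K Y" by (rule prob_space_distr) measurable
  have "indep_set (sets (vimage_algebra (space M) X N)) (sets (vimage_algebra (space M) Y K))"
  proof (rule indep_setI)
    fix a b assume "a \<in> sets (vimage_algebra (space M) X N)" "b \<in> sets (vimage_algebra (space M) Y K)"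
    moreover have "X \<in> space M \<rightarrow> space N" "Y \<in> space M \<rightarrow> space K"
      using measurable_space[OF assms(2)] measurable_space[OF assms(3)] by auto
    ultimately obtain A B where [measurable]: "A \<in> sets N" "B \<in> sets K"
      and ab: "a = X -` A \<inter> space M" "b = Y -` B \<inter> space M"
      by (auto simp: sets_vimage_algebra2)
    have "a \<inter> b = (\<lambda>\<omega>. (X \<omega>, Y \<omega>)) -` (A \<times> B) \<inter> space M"
      by (auto simp: ab)
    then have "emeasure M (a \<inter> b) = emeasure (distr M (N \<Otimes>\<^sub>M K) (\<lambda>\<omega>. (X \<omega>, Y \<omega>))) (A \<times> B)"
      by (simp add: emeasure_distr)
    also have "\<dots> = emeasure M a * emeasure M b"
      by (simp add: eq Y.emeasure_pair_measure_Times emeasure_distr ab)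
    finally show "prob (a \<inter> b) = prob a * prob b"
      by (simp add: emeasure_eq_measure flip: ennreal_mult')
  qed (use assms(2,3) in \<open>simp_all add: sets_image_in_sets\<close>)
  then show ?thesis by (simp add: indep_rv_def)
qed

text \<open>The sigma-algebra generated by \<open>X'\<close> lies inside that of \<open>X\<close>.
  In this form no explicit map from \<open>X\<close> to \<open>X'\<close> is required, which suits
  variables defined by recursion.\<close>

lemma indep_rv_measurable_vimage:
  assumes "prob_space M" "indep_rv M N X K Y"
    and X': "X' \<in> measurable (vimage_algebra (space M) X N) N'"
  shows "indep_rv M N' X' K Y"
proof -
  interpret prob_space M by fact
  note [measurable] = indep_rv_measurable[OF assms(2)]
  have sub: "sets (vimage_algebra (space M) X N) \<subseteq> events"
    by (rule sets_image_in_sets) measurable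
  have "X' \<in> measurable M N'"
    using measurable_space[OF X'] measurable_sets[OF X'] sub by (auto intro!: measurableI)
  moreover have "sets (vimage_algebra (space M) X' N') \<subseteq> sets (vimage_algebra (space M) X N)"
    using X' by (intro sets_image_in_sets) auto
  ultimately show ?thesis
    using assms(2) unfolding indep_rv_def by (auto simp: indep_sets2_eq)
qed

lemma indep_rv_compose_left:
  assumes "prob_space M" "indep_rv M N X K Y" and [measurable]: "f \<in> measurable N N'"
  shows "indep_rv M N' (\<lambda>\<omega>. f (X \<omega>)) K Y"
proof -
  have [measurable]: "X \<in> measurable (vimage_algebra (space M) X N) N"
    using indep_rv_measurable[OF assms(2)]
    by (intro measurable_vimage_algebra1) (auto dest: measurable_space)
  show ?thesis
    by (rule indep_rv_measurable_vimage[OF assms(1,2)]) measurable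
qed

lemma indep_rv_compose_right:
  assumes "prob_space M" "indep_rv M N X K Y" "f \<in> measurable K K'"
  shows "indep_rv M N X K' (\<lambda>\<omega>. f (Y \<omega>))"
  by (rule indep_rv_sym[OF assms(1) indep_rv_compose_left[OF assms(1) indep_rv_sym[OF assms(1,2)] assms(3)]])

text \<open>The two hypotheses make the joint law of the three variables a triple product, which may
  be regrouped. Equality is checked on \<open>A \<times> C\<close>, with \<open>A\<close> any
  measurable set of pairs, by integrating over \<open>y2\<close> first.\<close>

lemma indep_rv_assoc:
  assumes "prob_space M" and VY: "indep_rv M N V (N1 \<Otimes>\<^sub>M N2) (\<lambda>\<omega>. (Y1 \<omega>, Y2 \<omega>))"
    and YY: "indep_rv M N1 Y1 N2 Y2"
  shows "indep_rv M (N \<Otimes>\<^sub>M N1) (\<lambda>\<omega>. (V \<omega>, Y1 \<omega>)) N2 Y2"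
proof (rule indep_rvI_distr_pair)
  show "prob_space M" by fact
  interpret prob_space M by fact
  note [measurable] = indep_rv_measurable[OF VY] indep_rv_measurable[OF YY]
  show "(\<lambda>\<omega>. (V \<omega>, Y1 \<omega>)) \<in> measurable M (N \<Otimes>\<^sub>M N1)" "Y2 \<in> measurable M N2"
    by measurable
  interpret V: prob_space "distr M N V" by (rule prob_space_distr) measurable
  interpret Y1: prob_space "distr M N1 Y1" by (rule prob_space_distr) measurable
  interpret Y2: prob_space "distr M N2 Y2" by (rule prob_space_distr) measurable
  interpret VY1: prob_space "distr M (N \<Otimes>\<^sub>M N1) (\<lambda>\<omega>. (V \<omega>, Y1 \<omega>))" by (rule prob_space_distr) measurable
  interpret Y12: prob_space "distr M (N1 \<Otimes>\<^sub>M N2) (\<lambda>\<omega>. (Y1 \<omega>, Y2 \<omega>))" by (rule prob_space_distr) measurable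
  note YY' = indep_rv_distr_pair[OF assms(1) YY]
  note VY' = indep_rv_distr_pair[OF assms(1) VY]
  have VY1: "distr M (N \<Otimes>\<^sub>M N1) (\<lambda>\<omega>. (V \<omega>, Y1 \<omega>)) = distr M N V \<Otimes>\<^sub>M distr M N1 Y1"
    using indep_rv_compose_right[OF assms(1) VY measurable_fst]
    by (intro indep_rv_distr_pair assms) simp
  show "distr M ((N \<Otimes>\<^sub>M N1) \<Otimes>\<^sub>M N2) (\<lambda>\<omega>. ((V \<omega>, Y1 \<omega>), Y2 \<omega>)) =
      distr M (N \<Otimes>\<^sub>M N1) (\<lambda>\<omega>. (V \<omega>, Y1 \<omega>)) \<Otimes>\<^sub>M distr M N2 Y2"
  proof (rule sym, rule pair_measure_eqI)
    show "sigma_finite_measure (distr M (N \<Otimes>\<^sub>M N1) (\<lambda>\<omega>. (V \<omega>, Y1 \<omega>)))" "sigma_finite_measure (distr M N2 Y2)"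
      by unfold_locales
    fix A C assume "A \<in> sets (distr M (N \<Otimes>\<^sub>M N1) (\<lambda>\<omega>. (V \<omega>, Y1 \<omega>)))" "C \<in> sets (distr M N2 Y2)"
    then have [measurable]: "A \<in> sets (N \<Otimes>\<^sub>M N1)" "C \<in> sets N2" by auto
    have "emeasure (distr M ((N \<Otimes>\<^sub>M N1) \<Otimes>\<^sub>M N2) (\<lambda>\<omega>. ((V \<omega>, Y1 \<omega>), Y2 \<omega>))) (A \<times> C) =
        (\<integral>\<^sup>+\<omega>. indicator (A \<times> C) ((V \<omega>, Y1 \<omega>), Y2 \<omega>) \<partial>M)"
      by (subst nn_integral_indicator[symmetric], simp, subst nn_integral_distr) auto
    also have "\<dots> = (\<integral>\<^sup>+\<omega>. (\<lambda>(v, y1, y2). indicator A (v, y1) * indicator C y2) (V \<omega>, Y1 \<omega>, Y2 \<omega>) \<partial>M)"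
      by (intro nn_integral_cong) (simp add: indicator_def)
    also have "\<dots> = (\<integral>\<^sup>+z. (\<lambda>(v, y1, y2). indicator A (v, y1) * indicator C y2) z
        \<partial>distr M (N \<Otimes>\<^sub>M (N1 \<Otimes>\<^sub>M N2)) (\<lambda>\<omega>. (V \<omega>, Y1 \<omega>, Y2 \<omega>)))"
      by (subst nn_integral_distr) auto
    also have "\<dots> = (\<integral>\<^sup>+v. \<integral>\<^sup>+y. (\<lambda>(y1, y2). indicator A (v, y1) * indicator C y2) y
        \<partial>distr M (N1 \<Otimes>\<^sub>M N2) (\<lambda>\<omega>. (Y1 \<omega>, Y2 \<omega>)) \<partial>distr M N V)"
      unfolding VY' by (subst Y12.nn_integral_fst[symmetric]) (auto simp: case_prod_beta')
    also have "\<dots> = (\<integral>\<^sup>+v. \<integral>\<^sup>+y1. \<integral>\<^sup>+y2. indicator A (v, y1) * indicator C y2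
        \<partial>distr M N2 Y2 \<partial>distr M N1 Y1 \<partial>distr M N V)"
    proof (intro nn_integral_cong)
      fix v assume "v \<in> space (distr M N V)"
      then have [measurable]: "v \<in> space N" by simp
      show "(\<integral>\<^sup>+y. (\<lambda>(y1, y2). indicator A (v, y1) * indicator C y2) y \<partial>distr M (N1 \<Otimes>\<^sub>M N2) (\<lambda>\<omega>. (Y1 \<omega>, Y2 \<omega>))) =
         (\<integral>\<^sup>+y1. \<integral>\<^sup>+y2. indicator A (v, y1) * indicator C y2 \<partial>distr M N2 Y2 \<partial>distr M N1 Y1 :: ennreal)"
        unfolding YY' by (subst Y2.nn_integral_fst[symmetric]) (auto simp: case_prod_beta')
    qed
    also have "\<dots> = (\<integral>\<^sup>+v. (\<integral>\<^sup>+y1. indicator A (v, y1) \<partial>distr M N1 Y1) * emeasure (distr M N2 Y2) C \<partial>distr M N V)"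
      by (intro nn_integral_cong) (simp add: nn_integral_cmult nn_integral_multc)
    also have "\<dots> = (\<integral>\<^sup>+v. (\<integral>\<^sup>+y1. indicator A (v, y1) \<partial>distr M N1 Y1) \<partial>distr M N V) * emeasure (distr M N2 Y2) C"
      by (intro nn_integral_multc) measurable
    also have "(\<integral>\<^sup>+v. (\<integral>\<^sup>+y1. indicator A (v, y1) \<partial>distr M N1 Y1) \<partial>distr M N V) =
        emeasure (distr M (N \<Otimes>\<^sub>M N1) (\<lambda>\<omega>. (V \<omega>, Y1 \<omega>))) A"
      unfolding VY1 by (subst Y1.emeasure_pair_measure) auto
    finally show "emeasure (distr M (N \<Otimes>\<^sub>M N1) (\<lambda>\<omega>. (V \<omega>, Y1 \<omega>))) A * emeasure (distr M N2 Y2) C =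
        emeasure (distr M ((N \<Otimes>\<^sub>M N1) \<Otimes>\<^sub>M N2) (\<lambda>\<omega>. ((V \<omega>, Y1 \<omega>), Y2 \<omega>))) (A \<times> C)" ..
  qed simp
qed

text \<open>Tuples over the disjoint index sets \<open>J\<close> and \<open>{i}\<close> share a
  value type, so \<open>indep_var\<close> applies to them; evaluation at \<open>i\<close> then turns
  the one-element tuple into \<open>X i\<close>.\<close>

lemma indep_vars_imp_indep_rv_restrict:
  assumes "prob_space M" "prob_space.indep_vars M (\<lambda>_. N) X I" "J \<subseteq> I" "i \<in> I - J"
  shows "indep_rv M (PiM J (\<lambda>_. N)) (\<lambda>\<omega>. \<lambda>j\<in>J. X j \<omega>) N (X i)"
proof -
  interpret prob_space M by fact
  have "indep_var (PiM J (\<lambda>_. N)) (\<lambda>\<omega>. \<lambda>j\<in>J. X j \<omega>) (PiM {i} (\<lambda>_. N)) (\<lambda>\<omega>. \<lambda>j\<in>{i}. X j \<omega>)"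
    using assms by (intro indep_var_restrict[OF assms(2)]) auto
  then have "indep_rv M (PiM J (\<lambda>_. N)) (\<lambda>\<omega>. \<lambda>j\<in>J. X j \<omega>) (PiM {i} (\<lambda>_. N)) (\<lambda>\<omega>. \<lambda>j\<in>{i}. X j \<omega>)"
    by (intro indep_rvI_distr_pair assms) (auto simp: indep_var_distribution_eq)
  from indep_rv_compose_right[OF assms(1) this, of "\<lambda>x. x i" N] show ?thesis by simp
qed

subsection \<open>Domination of the noise shifted along a trajectory\<close>

text \<open>One step of the domination. By independence \<open>x\<close> can be frozen under Fubini;
  translation invariance of Lebesgue measure moves the shift from the argument of \<open>f\<close>
  into the density, where \<open>h\<close> bounds it.\<close>

lemma nn_integral_shifted_le:
  fixes Y :: "'a \<Rightarrow> 'b::euclidean_space"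
  assumes "prob_space M" and XY: "indep_rv M N X borel Y"
    and Y: "distributed M lborel Y \<phi>"
    and [measurable]: "u \<in> measurable N borel" "h \<in> borel_measurable borel" "f \<in> borel_measurable (N \<Otimes>\<^sub>M borel)"
    and h: "\<And>x y. x \<in> space N \<Longrightarrow> \<phi> (y + u x) \<le> h y"
  shows "(\<integral>\<^sup>+\<omega>. f (X \<omega>, Y \<omega> - u (X \<omega>)) \<partial>M) \<le> (\<integral>\<^sup>+\<omega>. \<integral>\<^sup>+y. f (X \<omega>, y) \<partial>density lborel h \<partial>M)"
proof -
  interpret prob_space M by fact
  note [measurable] = indep_rv_measurable[OF XY]
  interpret Y: prob_space "distr M borel Y" by (rule prob_space_distr) measurable
  have [measurable]: "\<phi> \<in> borel_measurable borel"
    using distributed_borel_measurable[OF Y] by simp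
  have dY: "distr M borel Y = density lborel \<phi>"
    using distributed_distr_eq_density[OF Y] distr_cong[of M M borel lborel Y Y] by simp
  interpret L: sigma_finite_measure "density lborel \<phi>"
    unfolding dY[symmetric] by unfold_locales
  \<comment> \<open>Since \<open>h\<close> may take the value \<infinity> here,
    \<open>density lborel h\<close> need not be sigma-finite; measurability is read off from the
    integral over \<open>lborel\<close>.\<close>
  have [measurable]: "(\<lambda>x. \<integral>\<^sup>+y. f (x, y) \<partial>density lborel h) \<in> borel_measurable N"
    by (subst measurable_cong[where g = "\<lambda>x. \<integral>\<^sup>+y. h y * f (x, y) \<partial>lborel"])
      (auto simp: nn_integral_density)
  have "(\<integral>\<^sup>+\<omega>. f (X \<omega>, Y \<omega> - u (X \<omega>)) \<partial>M) =
      (\<integral>\<^sup>+z. f (fst z, snd z - u (fst z)) \<partial>distr M (N \<Otimes>\<^sub>M borel) (\<lambda>\<omega>. (X \<omega>, Y \<omega>)))"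
    by (subst nn_integral_distr) auto
  also have "\<dots> = (\<integral>\<^sup>+x. \<integral>\<^sup>+y. f (x, y - u x) \<partial>density lborel \<phi> \<partial>distr M N X)"
    unfolding indep_rv_distr_pair[OF assms(1) XY] dY
    by (subst L.nn_integral_fst[symmetric]) auto
  also have "\<dots> \<le> (\<integral>\<^sup>+x. \<integral>\<^sup>+y. f (x, y) \<partial>density lborel h \<partial>distr M N X)"
  proof (rule nn_integral_mono)
    fix x assume "x \<in> space (distr M N X)"
    then have x [measurable]: "x \<in> space N" by simp
    have "(\<integral>\<^sup>+y. f (x, y - u x) \<partial>density lborel \<phi>) = (\<integral>\<^sup>+y. \<phi> y * f (x, y - u x) \<partial>lborel)"
      by (subst nn_integral_density) auto
    also have "\<dots> = (\<integral>\<^sup>+y. \<phi> y * f (x, y - u x) \<partial>distr lborel borel ((+) (u x)))"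
      by (simp add: lborel_distr_plus)
    also have "\<dots> = (\<integral>\<^sup>+y. \<phi> (y + u x) * f (x, y) \<partial>lborel)"
      by (subst nn_integral_distr) (auto simp: add.commute)
    also have "\<dots> \<le> (\<integral>\<^sup>+y. h y * f (x, y) \<partial>lborel)"
      by (intro nn_integral_mono mult_right_mono h x) simp
    also have "\<dots> = (\<integral>\<^sup>+y. f (x, y) \<partial>density lborel h)"
      by (subst nn_integral_density) auto
    finally show "(\<integral>\<^sup>+y. f (x, y - u x) \<partial>density lborel \<phi>) \<le> (\<integral>\<^sup>+y. f (x, y) \<partial>density lborel h)" .
  qed
  also have "\<dots> = (\<integral>\<^sup>+\<omega>. \<integral>\<^sup>+y. f (X \<omega>, y) \<partial>density lborel h \<partial>M)"
    by (subst nn_integral_distr) auto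
  finally show ?thesis .
qed

lemma tuple_Suc: "tuple (Suc t) X \<omega> = (tuple t X \<omega>)(Suc t := X (Suc t) \<omega>)"
  by (auto simp: fun_eq_iff restrict_def)

text \<open>Induction on \<open>t\<close>, removing the last coordinate. The shift of
  \<open>\<xi> (Suc t)\<close> depends only on \<open>V\<close> and the earlier
  \<open>\<zeta>\<close>, which are independent of \<open>\<xi> (Suc t)\<close>, so
  \<open>nn_integral_shifted_le\<close> replaces that coordinate by its dominating measure.\<close>

lemma nn_integral_shifted_noise_le:
  fixes \<xi> \<zeta> :: "nat \<Rightarrow> 'a \<Rightarrow> 'b::euclidean_space"
  assumes M: "prob_space M"
    and V: "indep_rv M N V (pow_space T borel) (tuple T \<xi>)"
    and \<xi>: "prob_space.indep_vars M (\<lambda>_. borel) \<xi> {1..T}"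
    and \<phi>: "\<And>t. t \<in> {1..T} \<Longrightarrow> distributed M lborel (\<xi> t) (\<phi> t)"
    and u: "\<And>t. t < T \<Longrightarrow> u t \<in> measurable (N \<Otimes>\<^sub>M pow_space t borel) borel"
    and \<zeta>: "\<And>t \<omega>. t < T \<Longrightarrow> \<omega> \<in> space M \<Longrightarrow> \<zeta> (Suc t) \<omega> = \<xi> (Suc t) \<omega> - u t (V \<omega>, tuple t \<zeta> \<omega>)"
    and h: "\<And>t. h t \<in> borel_measurable borel" "\<And>t y. h t y \<noteq> \<infinity>"
    and \<phi>h: "\<And>t x y. t < T \<Longrightarrow> x \<in> space (N \<Otimes>\<^sub>M pow_space t borel) \<Longrightarrow> \<phi> (Suc t) (y + u t x) \<le> h (Suc t) y"
    and t: "t \<le> T" and f: "f \<in> borel_measurable (N \<Otimes>\<^sub>M pow_space t borel)"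
  shows "(\<integral>\<^sup>+\<omega>. f (V \<omega>, tuple t \<zeta> \<omega>) \<partial>M) \<le>
    (\<integral>\<^sup>+\<omega>. \<integral>\<^sup>+y. f (V \<omega>, y) \<partial>PiM {1..t} (\<lambda>i. density lborel (h i)) \<partial>M)"
proof -
  interpret prob_space M by fact
  define H where "H i = density lborel (h i)" for i
  have setsH [measurable_cong]: "sets (H i) = sets borel" for i by (simp add: H_def)
  interpret H: product_sigma_finite H
    unfolding product_sigma_finite_def H_def
    using h by (auto simp: sigma_finite_measure.sigma_finite_iff_density_finite[OF lborel.sigma_finite_measure_axioms])
  have V_meas [measurable]: "V \<in> measurable M N"
    using indep_rv_measurable[OF V] by simp
  have \<xi>_meas: "\<xi> i \<in> borel_measurable M" if "i \<in> {1..T}" for i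
    using \<xi> that by (auto simp: indep_vars_def)
  \<comment> \<open>Stated for a general sigma-algebra \<open>G\<close> because it serves twice: for
    \<open>M\<close> itself and for the one generated by \<open>V\<close> and the first
    \<open>s\<close> noises.\<close>
  have \<zeta>_meas: "\<zeta> i \<in> borel_measurable G"
    if G: "space G = space M" "V \<in> measurable G N" "\<And>i. i \<in> {1..s} \<Longrightarrow> \<xi> i \<in> borel_measurable G"
      and "s \<le> T" "i \<in> {1..s}" for G s i
    using that(5)
  proof (induction i rule: less_induct)
    case (less i)
    then obtain k where k: "i = Suc k" "k < T" using \<open>s \<le> T\<close> by (cases i) auto
    note u[OF k(2), measurable] G(2)[measurable]
    have [measurable]: "\<zeta> j \<in> borel_measurable G" if "j \<in> {1..k}" for j
      using less that k by auto
    have [measurable]: "\<xi> i \<in> borel_measurable G" using less.prems G by auto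
    have "(\<lambda>\<omega>. \<xi> i \<omega> - u k (V \<omega>, tuple k \<zeta> \<omega>)) \<in> borel_measurable G"
      by measurable
    then show ?case
      using \<zeta>[OF k(2)] k G(1) by (subst measurable_cong) auto
  qed
  \<comment> \<open>The next noise is independent of \<open>V\<close> with the first
    \<open>s\<close> noises, and the shifted noises up to \<open>s\<close> are measurable with
    respect to these.\<close>
  have indep: "indep_rv M (N \<Otimes>\<^sub>M pow_space s borel) (\<lambda>\<omega>. (V \<omega>, tuple s \<zeta> \<omega>)) borel (\<xi> (Suc s))"
    if s: "s < T" for s
  proof -
    have "(\<lambda>x. (restrict x {1..s}, x (Suc s))) \<in> measurable (pow_space T borel) (pow_space s borel \<Otimes>\<^sub>M borel)"
      using s by (intro measurable_Pair measurable_restrict_subset measurable_component_singleton) auto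
    from indep_rv_compose_right[OF M V this]
    have "indep_rv M N V (pow_space s borel \<Otimes>\<^sub>M borel) (\<lambda>\<omega>. (tuple s \<xi> \<omega>, \<xi> (Suc s) \<omega>))"
      using s by (simp add: Int_absorb1)
    moreover have "indep_rv M (pow_space s borel) (tuple s \<xi>) borel (\<xi> (Suc s))"
      using s by (intro indep_vars_imp_indep_rv_restrict[OF M \<xi>]) auto
    ultimately have ind: "indep_rv M (N \<Otimes>\<^sub>M pow_space s borel) (\<lambda>\<omega>. (V \<omega>, tuple s \<xi> \<omega>)) borel (\<xi> (Suc s))"
      by (rule indep_rv_assoc[OF M])
    define G where "G = vimage_algebra (space M) (\<lambda>\<omega>. (V \<omega>, tuple s \<xi> \<omega>)) (N \<Otimes>\<^sub>M pow_space s borel)"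
    have G [measurable]: "(\<lambda>\<omega>. (V \<omega>, tuple s \<xi> \<omega>)) \<in> measurable G (N \<Otimes>\<^sub>M pow_space s borel)"
      using indep_rv_measurable[OF ind] unfolding G_def
      by (intro measurable_vimage_algebra1) (auto dest: measurable_space)
    have GV [measurable]: "V \<in> measurable G N"
      using measurable_compose[OF G measurable_fst] by simp
    have "\<xi> i \<in> borel_measurable G" if "i \<in> {1..s}" for i
      using measurable_compose[OF measurable_compose[OF G measurable_snd] measurable_component_singleton[OF that]] that
      by simp
    then have [measurable]: "\<zeta> i \<in> borel_measurable G" if "i \<in> {1..s}" for i
      using that s GV by (intro \<zeta>_meas[of G s]) (auto simp: G_def)
    have "(\<lambda>\<omega>. (V \<omega>, tuple s \<zeta> \<omega>)) \<in> measurable G (N \<Otimes>\<^sub>M pow_space s borel)"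
      by measurable
    then show ?thesis
      unfolding G_def by (rule indep_rv_measurable_vimage[OF M ind])
  qed
  have \<zeta>_M: "\<zeta> i \<in> borel_measurable M" if "i \<in> {1..T}" for i
    using that \<xi>_meas by (intro \<zeta>_meas[of M T]) auto
  have "(\<integral>\<^sup>+\<omega>. f (V \<omega>, tuple t \<zeta> \<omega>) \<partial>M) \<le> (\<integral>\<^sup>+\<omega>. \<integral>\<^sup>+y. f (V \<omega>, y) \<partial>PiM {1..t} H \<partial>M)"
    using t f
  proof (induction t arbitrary: f)
    case 0
    \<comment> \<open>The empty product is the unit mass at the empty tuple, so both sides
      agree.\<close>
    then show ?case by (simp add: PiM_empty nn_integral_count_space_finite restrict_def)
  next
    case (Suc t)
    then have t: "t < T" by simp
    have [measurable]: "f \<in> borel_measurable (N \<Otimes>\<^sub>M PiM (insert (Suc t) {1..t}) (\<lambda>_. borel))"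
      using Suc.prems by (simp add: atLeastAtMostSuc_conv)
    \<comment> \<open>\<open>f\<close> with its last coordinate split off. Its integral over that
      coordinate is the function fed to the induction hypothesis, which is why \<open>f\<close> is
      generalised.\<close>
    define f' where "f' x = f (fst (fst x), (snd (fst x))(Suc t := snd x))" for x
    have f' [measurable]: "f' \<in> borel_measurable ((N \<Otimes>\<^sub>M pow_space t borel) \<Otimes>\<^sub>M borel)"
      unfolding f'_def by measurable
    have k [measurable]: "(\<lambda>x. \<integral>\<^sup>+z. f' (x, z) \<partial>H (Suc t)) \<in> borel_measurable (N \<Otimes>\<^sub>M pow_space t borel)"
      using H.sigma_finite_measures[of "Suc t"] by measurable
    have "(\<integral>\<^sup>+\<omega>. f (V \<omega>, tuple (Suc t) \<zeta> \<omega>) \<partial>M) =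
        (\<integral>\<^sup>+\<omega>. f' ((V \<omega>, tuple t \<zeta> \<omega>), \<xi> (Suc t) \<omega> - u t (V \<omega>, tuple t \<zeta> \<omega>)) \<partial>M)"
      by (intro nn_integral_cong) (simp only: f'_def fst_conv snd_conv tuple_Suc \<zeta>[OF t])
    also have "\<dots> \<le> (\<integral>\<^sup>+\<omega>. \<integral>\<^sup>+z. f' ((V \<omega>, tuple t \<zeta> \<omega>), z) \<partial>H (Suc t) \<partial>M)"
      unfolding H_def using t
      by (intro nn_integral_shifted_le[OF M indep \<phi>] u h \<phi>h f') auto
    also have "\<dots> \<le> (\<integral>\<^sup>+\<omega>. \<integral>\<^sup>+y. \<integral>\<^sup>+z. f' ((V \<omega>, y), z) \<partial>H (Suc t) \<partial>PiM {1..t} H \<partial>M)"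
      by (rule Suc.IH[OF less_imp_le[OF t] k])
    also have "\<dots> = (\<integral>\<^sup>+\<omega>. \<integral>\<^sup>+y. f (V \<omega>, y) \<partial>PiM (insert (Suc t) {1..t}) H \<partial>M)"
    proof (intro nn_integral_cong)
      fix \<omega> assume "\<omega> \<in> space M"
      then have [measurable]: "V \<omega> \<in> space N" by (rule measurable_space[OF V_meas])
      have m: "(\<lambda>y. f (V \<omega>, y)) \<in> borel_measurable (PiM (insert (Suc t) {1..t}) H)"
        by (subst measurable_cong_sets[OF sets_PiM_cong[OF refl setsH] refl]) measurable
      show "(\<integral>\<^sup>+y. \<integral>\<^sup>+z. f' ((V \<omega>, y), z) \<partial>H (Suc t) \<partial>PiM {1..t} H) = (\<integral>\<^sup>+y. f (V \<omega>, y) \<partial>PiM (insert (Suc t) {1..t}) H)"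
        by (subst H.product_nn_integral_insert[OF _ _ m]) (auto simp: f'_def)
    qed
    also have "insert (Suc t) {1..t} = {1..Suc t}" by auto
    finally show ?case .
  qed
  then show ?thesis by (simp add: H_def[abs_def])
qed

section \<open>Trajectories as functions of the starting point and the increments\<close>

text \<open>With start \<open>W 0\<close> and increments \<open>\<zeta>\<close> this reproduces the
  iterates; data and batches enter only through the increments.\<close>

primrec driven :: "('b::plus \<Rightarrow> 'b) \<Rightarrow> 'b \<Rightarrow> (nat \<Rightarrow> 'b) \<Rightarrow> nat \<Rightarrow> 'b" where
  "driven g w y 0 = w"
| "driven g w y (Suc t) = g (driven g w y t) + y (Suc t)"

lemma driven_cong: "(\<And>i. i \<in> {1..t} \<Longrightarrow> y i = y' i) \<Longrightarrow> driven g w y t = driven g w y' t"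
  by (induction t) auto

lemma measurable_driven:
  fixes g :: "'b::euclidean_space \<Rightarrow> 'b"
  assumes [measurable]: "g \<in> borel_measurable borel" and "t \<le> T"
  shows "(\<lambda>(w, y). driven g w y t) \<in> borel_measurable (borel \<Otimes>\<^sub>M pow_space T borel)"
  using assms(2)
proof (induction t)
  case (Suc t)
  then have [measurable]: "(\<lambda>x. driven g (fst x) (snd x) t) \<in> borel_measurable (borel \<Otimes>\<^sub>M pow_space T borel)"
    by (simp add: case_prod_beta')
  have [measurable]: "(\<lambda>x. snd x (Suc t)) \<in> borel_measurable (borel \<Otimes>\<^sub>M pow_space T borel)"
    using Suc.prems by (intro measurable_compose[OF measurable_snd measurable_component_singleton]) auto
  show ?case unfolding driven.simps case_prod_beta' by measurable
qed (simp add: case_prod_beta')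

subsection \<open>The leakage bound\<close>

lemma ln_ext_le:
  assumes "x \<le> ennreal C" "0 < C"
  shows "ln_ext x \<le> ereal (ln C)"
proof -
  have "x \<noteq> \<infinity>" using assms by (auto simp: top_unique)
  then obtain r where r: "x = ennreal r" "r \<ge> 0" by (cases x) auto
  then show ?thesis using assms by (auto simp: ln_ext_def ennreal_le_iff)
qed

text \<open>On the set \<open>A\<close> where the derivative exceeds \<open>C\<close>, the setwise
  bound forces the integral of the excess to vanish, so the excess is zero almost
  everywhere.\<close>

lemma RN_deriv_le_AE:
  assumes "finite_measure Q" "absolutely_continuous Q P" "sets P = sets Q"
    and le: "\<And>E. E \<in> sets Q \<Longrightarrow> emeasure P E \<le> ennreal C * emeasure Q E"
  shows "AE x in Q. RN_deriv Q P x \<le> ennreal C"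
proof -
  interpret finite_measure Q by fact
  define A where "A = {x \<in> space Q. ennreal C < RN_deriv Q P x}"
  have [measurable]: "A \<in> sets Q" unfolding A_def by measurable
  have "(\<integral>\<^sup>+x. RN_deriv Q P x * indicator A x \<partial>Q) = emeasure P A"
    using density_RN_deriv[OF assms(2,3)] by (subst emeasure_density[symmetric]) auto
  also have "\<dots> \<le> ennreal C * emeasure Q A" by (rule le) measurable
  finally have int: "(\<integral>\<^sup>+x. RN_deriv Q P x * indicator A x \<partial>Q) \<le> ennreal C * emeasure Q A" .
  have fin: "ennreal C * emeasure Q A \<noteq> \<infinity>"
    by (simp add: ennreal_mult_eq_top_iff)
  \<comment> \<open>Subtraction in \<open>ennreal\<close> is truncated; the integral splits because
    the subtrahend has finite integral and is dominated by the minuend.\<close>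
  have "(\<integral>\<^sup>+x. RN_deriv Q P x * indicator A x - ennreal C * indicator A x \<partial>Q) =
      (\<integral>\<^sup>+x. RN_deriv Q P x * indicator A x \<partial>Q) - (\<integral>\<^sup>+x. ennreal C * indicator A x \<partial>Q)"
  proof (rule nn_integral_diff)
    show "(\<integral>\<^sup>+x. ennreal C * indicator A x \<partial>Q) \<noteq> \<infinity>"
      using fin by (simp add: nn_integral_cmult)
  qed (auto simp: A_def indicator_def)
  also have "\<dots> = 0"
    using int fin by (simp add: nn_integral_cmult diff_eq_0_iff_ennreal top.not_eq_extremum)
  finally have "AE x in Q. RN_deriv Q P x * indicator A x - ennreal C * indicator A x = 0"
    by (subst (asm) nn_integral_0_iff_AE) auto
  then show ?thesis
  proof (rule AE_mp, intro AE_I2 impI)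
    fix x assume x: "x \<in> space Q" "RN_deriv Q P x * indicator A x - ennreal C * indicator A x = 0"
    show "RN_deriv Q P x \<le> ennreal C"
    proof (rule ccontr)
      assume "\<not> RN_deriv Q P x \<le> ennreal C"
      with x show False by (simp add: A_def diff_eq_0_iff_ennreal)
    qed
  qed
qed

text \<open>Any admissible \<open>Q\<close> bounds the infimum from above. The setwise inequality
  gives both absolute continuity and a bound \<open>C\<close> on the Radon-Nikodym
  derivative.\<close>

lemma maximal_leakage_le:
  assumes "prob_space M" "X \<in> measurable M N" "Y \<in> measurable M K"
    and Q: "prob_space Q" "sets Q = sets K" and C: "0 < C"
    and le: "\<And>E. E \<in> sets (N \<Otimes>\<^sub>M K) \<Longrightarrow>
      emeasure (distr M (N \<Otimes>\<^sub>M K) (\<lambda>\<omega>. (X \<omega>, Y \<omega>))) E \<le> ennreal C * emeasure (distr M N X \<Otimes>\<^sub>M Q) E"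
  shows "maximal_leakage M N X K Y \<le> ereal (ln C)"
proof -
  define P where "P = distr M (N \<Otimes>\<^sub>M K) (\<lambda>\<omega>. (X \<omega>, Y \<omega>))"
  define R where "R = distr M N X \<Otimes>\<^sub>M Q"
  interpret prob_space M by fact
  interpret X: prob_space "distr M N X" by (rule prob_space_distr) fact
  interpret Q: prob_space Q by fact
  interpret R: pair_prob_space "distr M N X" Q ..
  have sets: "sets P = sets R"
    unfolding P_def R_def sets_distr by (intro sets_pair_measure_cong) (simp_all add: Q)
  have le': "emeasure P E \<le> ennreal C * emeasure R E" if "E \<in> sets R" for E
    using le[of E] that sets by (simp add: P_def R_def)
  have ac: "absolutely_continuous R P"
  proof (unfold absolutely_continuous_def, safe)
    fix E assume "E \<in> null_sets R"
    then show "E \<in> null_sets P"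
      using le'[of E] sets by (auto simp: null_sets_def)
  qed
  have R: "finite_measure R" unfolding R_def by unfold_locales
  have "AE x in R. RN_deriv R P x \<le> ennreal C"
    by (rule RN_deriv_le_AE[OF R ac sets le'])
  \<comment> \<open>The essential supremum in \<open>renyi_div_inf\<close> is taken under
    \<open>P\<close>, so the bound is carried over from \<open>R\<close> by absolute
    continuity.\<close>
  then have "AE x in P. RN_deriv R P x \<le> ennreal C"
    by (rule absolutely_continuous_AE[OF sets ac])
  moreover have "RN_deriv R P \<in> borel_measurable P"
    using sets measurable_cong_sets[of P R borel borel] by simp
  ultimately have "esssup P (RN_deriv R P) \<le> ennreal C"
    by (intro esssup_I)
  then have "renyi_div_inf P R \<le> ereal (ln C)"
    using ac C by (simp add: renyi_div_inf_def ln_ext_le)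
  moreover have "maximal_leakage M N X K Y \<le> renyi_div_inf P R"
    unfolding maximal_leakage_def P_def R_def using Q by (intro INF_lower) auto
  ultimately show ?thesis by simp
qed

theorem theorem4:
  fixes M :: "'a measure"
    and \<mu> :: "'z measure"
    and B :: "'z multiset measure"
    and K :: "'o measure"
    and n T :: nat
    and p L :: real
    and \<eta> \<sigma> :: "nat \<Rightarrow> real"
    and Z' :: "nat \<Rightarrow> 'a \<Rightarrow> 'z"
    and Z :: "nat \<Rightarrow> 'a \<Rightarrow> 'z multiset"
    and W \<xi> :: "nat \<Rightarrow> 'a \<Rightarrow> real ^ 'd"
    and g :: "real ^ 'd \<Rightarrow> real ^ 'd"
    and F :: "real ^ 'd \<Rightarrow> 'z multiset \<Rightarrow> real ^ 'd"
    and out :: "(nat \<Rightarrow> real ^ 'd) \<Rightarrow> 'o"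
  assumes M: "prob_space M"
    and p: "0 < p" "p \<le> 2"
    and L: "L > 0"
    and eta: "\<And>t. t \<in> {1..T} \<Longrightarrow> \<eta> t > 0"
    and sigma: "\<And>t. t \<in> {1..T} \<Longrightarrow> \<sigma> t > 0"
    \<comment> \<open>the data set \<open>S = (Z'\<^sub>1, \<dots>, Z'\<^sub>n)\<close> and the mini-batches \<open>Z\<^sub>t \<subseteq> S\<close>\<close>
    and mu: "prob_space \<mu>"
    and samples_indep: "prob_space.indep_vars M (\<lambda>_. \<mu>) Z' {1..n}"
    and samples_ident: "\<And>i. i \<in> {1..n} \<Longrightarrow> distr M \<mu> (Z' i) = \<mu>"
    and batch_measurable: "\<And>t. t \<in> {1..T} \<Longrightarrow> Z t \<in> measurable M B"
    and batch_subset: "\<And>t \<omega>. t \<in> {1..T} \<Longrightarrow> \<omega> \<in> space M \<Longrightarrow>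
      Z t \<omega> \<subseteq># image_mset (\<lambda>i. Z' i \<omega>) (mset_set {1..n})"
    \<comment> \<open>the update rule\<close>
    and g_measurable: "g \<in> measurable borel borel"
    and F_measurable: "(\<lambda>(w, z). F w z) \<in> measurable (borel \<Otimes>\<^sub>M B) borel"
    and update: "\<And>t \<omega>. t \<in> {1..T} \<Longrightarrow> \<omega> \<in> space M \<Longrightarrow>
      W t \<omega> = g (W (t - 1) \<omega>) - \<eta> t *\<^sub>R F (W (t - 1) \<omega>) (Z t \<omega>) + \<xi> t \<omega>"
    and init_indep: "indep_rv M borel (W 0) (pow_space n \<mu> \<Otimes>\<^sub>M pow_space T B)
      (\<lambda>\<omega>. (tuple n Z' \<omega>, tuple T Z \<omega>))"
    and noise_mutually_indep: "prob_space.indep_vars M (\<lambda>_. borel) \<xi> {1..T}"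
    and noise_indep: "indep_rv M (pow_space T borel) (tuple T \<xi>)
      (borel \<Otimes>\<^sub>M pow_space n \<mu> \<Otimes>\<^sub>M pow_space T B)
      (\<lambda>\<omega>. (W 0 \<omega>, tuple n Z' \<omega>, tuple T Z \<omega>))"
    \<comment> \<open>\<open>P(Z\<^sub>t\<^sub>+\<^sub>1 | Z\<^sup>t, W\<^sup>t, S) = P(Z\<^sub>t\<^sub>+\<^sub>1 | Z\<^sup>t, S)\<close>\<close>
    and sampling: "\<And>t A. t < T \<Longrightarrow> A \<in> sets B \<Longrightarrow>
      (AE \<omega> in M.
        cond_prob_given M (Z (t + 1)) A (pow_space t B \<Otimes>\<^sub>M pow_space t borel \<Otimes>\<^sub>M pow_space n \<mu>)
          (\<lambda>\<omega>. (tuple t Z \<omega>, tuple t W \<omega>, tuple n Z' \<omega>)) \<omega> =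
        cond_prob_given M (Z (t + 1)) A (pow_space t B \<Otimes>\<^sub>M pow_space n \<mu>)
          (\<lambda>\<omega>. (tuple t Z \<omega>, tuple n Z' \<omega>)) \<omega>)"
    and F_bounded: "\<And>w z. z \<in> space B \<Longrightarrow> lp_norm p (F w z) \<le> L"
    and noise_normal: "\<And>t. t \<in> {1..T} \<Longrightarrow> distributed M lborel (\<xi> t) (iso_normal_density (\<sigma> t))"
    \<comment> \<open>the final output is a function of \<open>W\<^sup>T\<close>\<close>
    and out_measurable: "out \<in> measurable (pow_space T borel) K"
  shows "maximal_leakage M (pow_space n \<mu>) (tuple n Z') K (\<lambda>\<omega>. out (tuple T W \<omega>))
    \<le> ereal (\<Sum>t=1..T. ln (V2 CARD('d) (\<eta> t * L) / (2 * pi * (\<sigma> t)\<^sup>2) powr (real CARD('d) / 2)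
        + 1 / Gamma (real CARD('d) / 2) *
          (\<Sum>i=0..CARD('d) - 1. real ((CARD('d) - 1) choose i) * Gamma ((real i + 1) / 2) *
             (\<eta> t * L / (\<sigma> t * sqrt 2)) ^ (CARD('d) - 1 - i))))"
proof -
  interpret prob_space M by fact
  define D where "D = CARD('d)"
  define C where "C t = V2 D (\<eta> t * L) / (2 * pi * (\<sigma> t)\<^sup>2) powr (real D / 2)
        + 1 / Gamma (real D / 2) *
          (\<Sum>i=0..D - 1. real ((D - 1) choose i) * Gamma ((real i + 1) / 2) *
             (\<eta> t * L / (\<sigma> t * sqrt 2)) ^ (D - 1 - i))" for t
  \<comment> \<open>The ball term is positive since its radius \<open>\<eta> t * L\<close> is; the
    sum is nonnegative.\<close>
  have C_pos: "C t > 0" if t: "t \<in> {1..T}" for t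
  proof -
    have "0 < \<eta> t * L" "0 < \<eta> t * L / (\<sigma> t * sqrt 2)" using eta[OF t] sigma[OF t] L by auto
    then show ?thesis
      unfolding C_def V2_def using sigma[OF t]
      by (intro add_pos_nonneg mult_nonneg_nonneg divide_pos_pos sum_nonneg mult_pos_pos)
        (auto simp: D_def Gamma_real_pos less_imp_le)
  qed
  \<comment> \<open>Everything the noise is jointly independent of, with all mini-batches included
    from the start.\<close>
  define V where "V \<omega> = (W 0 \<omega>, tuple n Z' \<omega>, tuple T Z \<omega>)" for \<omega>
  define NV where "NV = (borel :: (real ^ 'd) measure) \<Otimes>\<^sub>M pow_space n \<mu> \<Otimes>\<^sub>M pow_space T B"
  define \<zeta> where "\<zeta> t \<omega> = \<xi> t \<omega> - \<eta> t *\<^sub>R F (W (t - 1) \<omega>) (Z t \<omega>)" for t \<omega>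
  \<comment> \<open>The shift at time \<open>Suc t\<close> as a function of \<open>V\<close> and the
    first \<open>t\<close> increments: \<open>driven\<close> recovers the current iterate, and the
    batch is read from the tuple inside \<open>V\<close>.\<close>
  define u where "u t x = \<eta> (Suc t) *\<^sub>R F (driven g (fst (fst x)) (snd x) t) (snd (snd (fst x)) (Suc t))"
    for t and x :: "((real ^ 'd) \<times> (nat \<Rightarrow> 'z) \<times> (nat \<Rightarrow> 'z multiset)) \<times> (nat \<Rightarrow> real ^ 'd)"
  define h where "h t y = ennreal (swollen_normal_density (\<sigma> t) (\<eta> t * L) (y :: real ^ 'd))" for t y
  define H where "H = PiM {1..T} (\<lambda>t. density lborel (h t))"
  define path where "path = (\<lambda>(w, y). \<lambda>t\<in>{1..T}. driven g w y t)"

  \<comment> \<open>The iterates as functions of \<open>W 0\<close> and the increments\<close>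
  have W0_meas [measurable]: "W 0 \<in> borel_measurable M"
    using indep_rv_measurable[OF init_indep] by simp
  have S_meas [measurable]: "tuple n Z' \<in> measurable M (pow_space n \<mu>)"
    using measurable_compose[OF indep_rv_measurable(2)[OF init_indep] measurable_fst] by simp
  have W: "W t \<omega> = driven g (W 0 \<omega>) (\<lambda>i. \<zeta> i \<omega>) t" if "t \<le> T" "\<omega> \<in> space M" for t \<omega>
    using that by (induction t) (auto simp: \<zeta>_def update)
  \<comment> \<open>Up to time \<open>t\<close> only increments with index at most \<open>t\<close>
    are read, so the increments may be truncated at any \<open>s \<ge> t\<close>.\<close>
  have W_tuple: "W t \<omega> = driven g (W 0 \<omega>) (tuple s \<zeta> \<omega>) t" if "t \<le> s" "s \<le> T" "\<omega> \<in> space M" for s t \<omega>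
    using that by (subst W) (auto intro!: driven_cong)
  have driven_meas: "(\<lambda>x. driven g (fst x) (snd x) t) \<in> borel_measurable (borel \<Otimes>\<^sub>M pow_space s borel)"
    if "t \<le> s" for s t
    using measurable_driven[OF g_measurable that] by (simp add: case_prod_beta')
  have path_meas [measurable]: "path \<in> measurable (borel \<Otimes>\<^sub>M pow_space T borel) (pow_space T borel)"
    unfolding path_def case_prod_beta' by (intro measurable_restrict driven_meas) auto
  have path: "tuple T W \<omega> = path (W 0 \<omega>, tuple T \<zeta> \<omega>)" if "\<omega> \<in> space M" for \<omega>
    unfolding path_def prod.case using that by (intro restrict_ext W_tuple) auto
  note out_measurable [measurable]

  \<comment> \<open>The shift and the resulting domination\<close>
  have u_meas: "u t \<in> borel_measurable (NV \<Otimes>\<^sub>M pow_space t borel)" if "t < T" for t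
  proof -
    have "(\<lambda>x. (driven g (fst (fst x)) (snd x) t, snd (snd (fst x)) (Suc t))) \<in>
        measurable (NV \<Otimes>\<^sub>M pow_space t borel) (borel \<Otimes>\<^sub>M B)"
    proof (intro measurable_Pair)
      have "(\<lambda>x. (fst (fst x), snd x)) \<in> measurable (NV \<Otimes>\<^sub>M pow_space t borel) (borel \<Otimes>\<^sub>M pow_space t borel)"
        unfolding NV_def by measurable
      from measurable_compose[OF this driven_meas[of t t]]
      show "(\<lambda>x. driven g (fst (fst x)) (snd x) t) \<in> borel_measurable (NV \<Otimes>\<^sub>M pow_space t borel)"
        by simp
      have "(\<lambda>x. snd (snd (fst x))) \<in> measurable (NV \<Otimes>\<^sub>M pow_space t borel) (pow_space T B)"
        unfolding NV_def by measurable
      from measurable_compose[OF this measurable_component_singleton[of "Suc t"]]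
      show "(\<lambda>x. snd (snd (fst x)) (Suc t)) \<in> measurable (NV \<Otimes>\<^sub>M pow_space t borel) B"
        using that by simp
    qed
    from measurable_compose[OF this F_measurable] show ?thesis
      unfolding u_def by simp
  qed
  have shift: "\<zeta> (Suc t) \<omega> = \<xi> (Suc t) \<omega> - u t (V \<omega>, tuple t \<zeta> \<omega>)" if "t < T" "\<omega> \<in> space M" for t \<omega>
    using that W_tuple[of t t \<omega>] by (simp add: \<zeta>_def u_def V_def)
  have dominated: "ennreal (iso_normal_density (\<sigma> (Suc t)) (y + u t x)) \<le> h (Suc t) y"
    if t: "t < T" and x: "x \<in> space (NV \<Otimes>\<^sub>M pow_space t borel)" for t x y
  proof -
    \<comment> \<open>\<open>F_bounded\<close> speaks about batches in \<open>space B\<close>, so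
      membership comes first; the bound then passes to the Euclidean norm.\<close>
    have "snd (snd (fst x)) (Suc t) \<in> space B"
      using x t by (auto simp: NV_def space_pair_measure space_PiM PiE_iff)
    then have "norm (F (driven g (fst (fst x)) (snd x) t) (snd (snd (fst x)) (Suc t))) \<le> L"
      using norm_le_lp_norm[OF p] F_bounded order_trans by blast
    then have "norm (u t x) \<le> \<eta> (Suc t) * L"
      using eta[of "Suc t"] t by (simp add: u_def mult_left_mono)
    then show ?thesis
      by (simp add: h_def iso_normal_density_le_swollen ennreal_leI)
  qed
  have [measurable]: "h t \<in> borel_measurable borel" for t
    unfolding h_def[abs_def] by measurable
  have h_fin: "h t y \<noteq> \<top>" for t y by (simp add: h_def)
  have key: "(\<integral>\<^sup>+\<omega>. f (V \<omega>, tuple T \<zeta> \<omega>) \<partial>M) \<le> (\<integral>\<^sup>+\<omega>. \<integral>\<^sup>+y. f (V \<omega>, y) \<partial>H \<partial>M)"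
    if f: "f \<in> borel_measurable (NV \<Otimes>\<^sub>M pow_space T borel)" for f
    unfolding H_def
  proof (rule nn_integral_shifted_noise_le[OF M _ noise_mutually_indep noise_normal u_meas shift _ _ dominated order_refl f])
    show "indep_rv M NV V (pow_space T borel) (tuple T \<xi>)"
      using indep_rv_sym[OF M noise_indep] by (simp add: NV_def V_def[abs_def])
  qed (auto simp: h_fin)

  \<comment> \<open>The dominating measure and its normalisation\<close>
  interpret HP: product_sigma_finite "\<lambda>t. density lborel (h t)"
    unfolding product_sigma_finite_def
    by (auto simp: sigma_finite_measure.sigma_finite_iff_density_finite[OF lborel.sigma_finite_measure_axioms] h_fin)
  have sets_H [measurable_cong]: "sets H = sets (pow_space T borel)"
    unfolding H_def by (intro sets_PiM_cong) auto
  have "emeasure H (space H) = (\<Prod>t\<in>{1..T}. \<integral>\<^sup>+y. h t y \<partial>lborel)"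
    unfolding H_def space_PiM by (subst HP.emeasure_PiM) (auto simp: emeasure_density)
  also have "\<dots> = (\<Prod>t\<in>{1..T}. ennreal (C t))"
  proof (intro prod.cong refl)
    fix t assume t: "t \<in> {1..T}"
    show "(\<integral>\<^sup>+y. h t y \<partial>lborel) = ennreal (C t)"
      unfolding h_def C_def D_def using sigma[OF t] eta[OF t] L
      by (intro nn_integral_swollen_normal_density) auto
  qed
  also have "\<dots> = ennreal (\<Prod>t\<in>{1..T}. C t)"
    using C_pos by (intro prod_ennreal) (auto simp: less_imp_le)
  finally have H_total: "emeasure H (space H) = ennreal (\<Prod>t\<in>{1..T}. C t)" .
  define c where "c = (\<Prod>t\<in>{1..T}. C t)"
  have c: "c > 0" unfolding c_def using C_pos by (intro prod_pos) auto
  interpret H: finite_measure H by (rule finite_measureI) (simp add: H_total)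
  interpret W0: prob_space "distr M borel (W 0)" by (rule prob_space_distr) measurable
  interpret S: prob_space "distr M (pow_space n \<mu>) (tuple n Z')" by (rule prob_space_distr) measurable
  define R where "R = distr M borel (W 0) \<Otimes>\<^sub>M H"
  have sets_R [measurable_cong]: "sets R = sets (borel \<Otimes>\<^sub>M pow_space T borel)"
    unfolding R_def by (intro sets_pair_measure_cong) (simp_all add: sets_H)
  have R_total: "emeasure R (space R) = ennreal c"
    unfolding R_def space_pair_measure
    using W0.emeasure_space_1 by (subst H.emeasure_pair_measure_Times) (auto simp: H_total c_def)
  \<comment> \<open>The candidate for the infimum: the law of \<open>W 0\<close> times
    \<open>H\<close>, divided by its mass \<open>c\<close> and pushed through the output map.
    Neither data nor batches enter.\<close>
  define Q where "Q = distr (scale_measure (ennreal (1 / c)) R) K (\<lambda>x. out (path x))"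
  have out_path [measurable]: "(\<lambda>x. out (path x)) \<in> measurable (scale_measure (ennreal (1 / c)) R) K"
    by measurable
  interpret Q: prob_space Q
  proof
    have "(\<lambda>x. out (path x)) -` space K \<inter> space R = space R"
      using measurable_space[OF out_path] by (auto simp: space_scale_measure)
    then have "emeasure Q (space Q) = ennreal (1 / c) * ennreal c"
      unfolding Q_def by (simp add: emeasure_distr space_scale_measure R_total)
    then show "emeasure Q (space Q) = 1"
      using c by (simp flip: ennreal_mult')
  qed

  \<comment> \<open>Setwise comparison with the product law\<close>
  have "maximal_leakage M (pow_space n \<mu>) (tuple n Z') K (\<lambda>\<omega>. out (tuple T W \<omega>)) \<le> ereal (ln c)"
  proof (rule maximal_leakage_le[OF M S_meas _ Q.prob_space_axioms _ c])
    have \<xi>_meas: "\<xi> i \<in> borel_measurable M" if "i \<in> {1..T}" for i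
      using noise_mutually_indep that by (auto simp: indep_vars_def)
    have W_meas: "W t \<in> borel_measurable M" if "t \<le> T" for t
      using that
    proof (induction t)
      case (Suc t)
      then have "Suc t \<in> {1..T}" by simp
      note [measurable] = \<xi>_meas[OF this] batch_measurable[OF this] g_measurable
      have [measurable]: "W t \<in> borel_measurable M" using Suc by simp
      have [measurable]: "(\<lambda>\<omega>. F (W t \<omega>) (Z (Suc t) \<omega>)) \<in> borel_measurable M"
        using measurable_compose[OF measurable_Pair F_measurable, of "W t" M "Z (Suc t)"] by simp
      show ?case
        by (subst measurable_cong[OF update[OF \<open>Suc t \<in> {1..T}\<close>]]) simp_all
    qed simp
    then have [measurable]: "tuple T W \<in> measurable M (pow_space T borel)"
      by (intro measurable_restrict) auto
    show Y_meas [measurable]: "(\<lambda>\<omega>. out (tuple T W \<omega>)) \<in> measurable M K"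
      by measurable
    show "sets Q = sets K" by (simp add: Q_def)
    fix E assume E [measurable]: "E \<in> sets (pow_space n \<mu> \<Otimes>\<^sub>M K)"
    define f where "f x = (indicator E (fst (snd (fst x)), out (path (fst (fst x), snd x))) :: ennreal)"
      for x :: "((real ^ 'd) \<times> (nat \<Rightarrow> 'z) \<times> (nat \<Rightarrow> 'z multiset)) \<times> (nat \<Rightarrow> real ^ 'd)"
    have f [measurable]: "f \<in> borel_measurable (NV \<Otimes>\<^sub>M pow_space T borel)"
      unfolding f_def NV_def by measurable
    have k_meas: "(\<lambda>z. \<integral>\<^sup>+y. indicator E (fst z, out (path (snd z, y))) \<partial>H) \<in>
        borel_measurable (pow_space n \<mu> \<Otimes>\<^sub>M borel)"
      using H.sigma_finite_measure_axioms by measurable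
    have SW: "indep_rv M (pow_space n \<mu>) (tuple n Z') borel (W 0)"
      using indep_rv_compose_left[OF M indep_rv_sym[OF M init_indep] measurable_fst] by simp
    have "emeasure (distr M (pow_space n \<mu> \<Otimes>\<^sub>M K) (\<lambda>\<omega>. (tuple n Z' \<omega>, out (tuple T W \<omega>)))) E =
        (\<integral>\<^sup>+z. indicator E z \<partial>distr M (pow_space n \<mu> \<Otimes>\<^sub>M K) (\<lambda>\<omega>. (tuple n Z' \<omega>, out (tuple T W \<omega>))))"
      using E by simp
    also have "\<dots> = (\<integral>\<^sup>+\<omega>. indicator E (tuple n Z' \<omega>, out (tuple T W \<omega>)) \<partial>M)"
      by (rule nn_integral_distr) measurable
    also have "\<dots> = (\<integral>\<^sup>+\<omega>. f (V \<omega>, tuple T \<zeta> \<omega>) \<partial>M)"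
      by (intro nn_integral_cong) (simp only: f_def V_def fst_conv snd_conv path)
    also have "\<dots> \<le> (\<integral>\<^sup>+\<omega>. \<integral>\<^sup>+y. f (V \<omega>, y) \<partial>H \<partial>M)"
      by (rule key) measurable
    also have "\<dots> = (\<integral>\<^sup>+\<omega>. \<integral>\<^sup>+y. indicator E (tuple n Z' \<omega>, out (path (W 0 \<omega>, y))) \<partial>H \<partial>M)"
      by (simp add: f_def V_def)
    \<comment> \<open>The integrand sees \<open>V\<close> only through the data and
      \<open>W 0\<close>, so the law of this pair suffices; by \<open>SW\<close> it is a product,
      which separates the data from the output law.\<close>
    also have "\<dots> = (\<integral>\<^sup>+z. \<integral>\<^sup>+y. indicator E (fst z, out (path (snd z, y))) \<partial>H
        \<partial>distr M (pow_space n \<mu> \<Otimes>\<^sub>M borel) (\<lambda>\<omega>. (tuple n Z' \<omega>, W 0 \<omega>)))"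
    proof (subst nn_integral_distr)
      show "(\<lambda>\<omega>. (tuple n Z' \<omega>, W 0 \<omega>)) \<in> measurable M (pow_space n \<mu> \<Otimes>\<^sub>M borel)"
        by measurable
    qed (simp_all only: measurable_distr_eq1 k_meas fst_conv snd_conv)
    also have "\<dots> = (\<integral>\<^sup>+s. \<integral>\<^sup>+w. \<integral>\<^sup>+y. indicator E (s, out (path (w, y))) \<partial>H
        \<partial>distr M borel (W 0) \<partial>distr M (pow_space n \<mu>) (tuple n Z'))"
      unfolding indep_rv_distr_pair[OF M SW]
    proof (subst W0.nn_integral_fst[symmetric])
      show "(\<lambda>z. \<integral>\<^sup>+y. indicator E (fst z, out (path (snd z, y))) \<partial>H) \<in>
          borel_measurable (distr M (pow_space n \<mu>) (tuple n Z') \<Otimes>\<^sub>M distr M borel (W 0))"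
        using H.sigma_finite_measure_axioms by measurable
    qed (simp only: fst_conv snd_conv)
    also have "\<dots> = (\<integral>\<^sup>+s. ennreal c * emeasure Q (Pair s -` E) \<partial>distr M (pow_space n \<mu>) (tuple n Z'))"
    proof (intro nn_integral_cong)
      fix s assume "s \<in> space (distr M (pow_space n \<mu>) (tuple n Z'))"
      then have s [measurable]: "s \<in> space (pow_space n \<mu>)" by simp
      have [measurable]: "Pair s -` E \<in> sets K" by (rule sets_Pair1) measurable
      have "(\<integral>\<^sup>+w. \<integral>\<^sup>+y. indicator E (s, out (path (w, y))) \<partial>H \<partial>distr M borel (W 0)) =
          (\<integral>\<^sup>+x. indicator (Pair s -` E) (out (path x)) \<partial>R)"
        unfolding R_def by (subst H.nn_integral_fst[symmetric]) (auto simp: indicator_def)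
      \<comment> \<open>Inserting \<open>c * (1 / c) = 1\<close> makes the scaled measure inside
        \<open>Q\<close> appear.\<close>
      also have "\<dots> = ennreal c * (ennreal (1 / c) * (\<integral>\<^sup>+x. indicator (Pair s -` E) (out (path x)) \<partial>R))"
        using c by (simp add: ennreal_mult'[symmetric] flip: mult.assoc)
      also have "\<dots> = ennreal c * (\<integral>\<^sup>+x. indicator (Pair s -` E) x \<partial>Q)"
        unfolding Q_def
        by (subst nn_integral_distr, measurable, subst nn_integral_scale_measure) auto
      also have "\<dots> = ennreal c * emeasure Q (Pair s -` E)"
        by (subst nn_integral_indicator) (auto simp: Q_def)
      finally show "(\<integral>\<^sup>+w. \<integral>\<^sup>+y. indicator E (s, out (path (w, y))) \<partial>H \<partial>distr M borel (W 0)) =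
          ennreal c * emeasure Q (Pair s -` E)" .
    qed
    also have "\<dots> = ennreal c * emeasure (distr M (pow_space n \<mu>) (tuple n Z') \<Otimes>\<^sub>M Q) E"
    proof -
      have E': "E \<in> sets (distr M (pow_space n \<mu>) (tuple n Z') \<Otimes>\<^sub>M Q)"
        using E sets_pair_measure_cong[of "distr M (pow_space n \<mu>) (tuple n Z')" "pow_space n \<mu>" Q K]
        by (simp add: Q_def)
      show ?thesis
        unfolding Q.emeasure_pair_measure_alt[OF E']
        by (rule nn_integral_cmult[OF Q.measurable_emeasure_Pair[OF E']])
    qed
    finally show "emeasure (distr M (pow_space n \<mu> \<Otimes>\<^sub>M K) (\<lambda>\<omega>. (tuple n Z' \<omega>, out (tuple T W \<omega>)))) E
        \<le> ennreal c * emeasure (distr M (pow_space n \<mu>) (tuple n Z') \<Otimes>\<^sub>M Q) E" .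
  qed
  also have "ln c = (\<Sum>t=1..T. ln (C t))"
    unfolding c_def
  proof (intro ln_prod)
    show "C t \<noteq> 0" if "t \<in> {1..T}" for t using C_pos[OF that] by simp
  qed auto
  finally show ?thesis
    by (simp only: C_def D_def)
qed

end
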